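(* We have the identity $$\sum_{k=1}^\infty \frac{(-27)^{k}}{k^3 \binom{2k}{k}^2 \binom{3k}{k}} \Big( (15k-4) (3 H_{3k-1} - H_{k-1}) - 9 \Big) = -\frac{4\pi^3}{\sqrt3}.$$
   Context: For $n\in\{0,1,2,\ldots\}$, $H_n=\sum_{0<j\le n}\frac1j$ denotes the usual harmonic number (so $H_0=0$). *)

theory Defs
  imports "HOL-Analysis.Harmonic_Numbers"
begin

end

theory Submission
  imports Defs "HOL-Analysis.Gamma_Function"
begin

text \<open>
  The factor \<open>3 H\<^bsub>3k-1\<^esub> - H\<^bsub>k-1\<^esub>\<close> is the sum of \<open>1/(j + 1/3) + 1/(j + 2/3)\<close> over
  \<open>j < k\<close>, so it is a logarithmic derivative of Pochhammer symbols with bases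
  \<open>1/3\<close> and \<open>2/3\<close>: the series is the derivative of a hypergeometric series
  with respect to a common shift \<open>x\<close> of these two bases. The undifferentiated series accelerates an
  elementary one. With \<open>y = x + d\<close> and \<open>d\<close> fixed, the Wilf-Zeilberger pair
  \<open>F\<^sub>k(x)\<close>, \<open>G\<^sub>k(x)\<close> given by \<open>wzF\<close> and \<open>wzG\<close> satisfies

  \<open>F\<^sub>k(x) - F\<^sub>k(x + 1) = G\<^sub>k(x) - G\<^bsub>k+1\<^esub>(x)\<close>   and   \<open>d G\<^sub>0(x) = 1/x\<^sup>2 - 1/y\<^sup>2\<close>,

  and this would give the sum of \<open>F\<^sub>k(x)\<close> over \<open>k\<close> as the sum of \<open>G\<^sub>0(x + n)\<close> over \<open>n\<close>.
  The pair comes from the well-poised sum of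
  \<open>(a + 2n) ((b)\<^sub>n (c)\<^sub>n)\<^sup>2 / ((1 + a - b)\<^sub>n (1 + a - c)\<^sub>n)\<^sup>2\<close> over \<open>n\<close>, starting at \<open>a = b + c\<close>:
  each step in \<open>k\<close> raises \<open>a\<close> by \<open>1\<close> with \<open>b\<close> and \<open>c\<close> fixed. Raising \<open>b\<close> and \<open>c\<close> by \<open>1\<close> and \<open>a\<close>
  by \<open>2\<close> amounts to the shift \<open>n \<mapsto> n + 1\<close>, so the summation variable extends to a real variable \<open>x = b + n\<close>.

  The WZ equation holds identically in the real variable \<open>x\<close>, so it may be differentiated in \<open>x\<close>
  (\<open>wz_identity_deriv\<close>). The derivatives form a WZ pair again, and
  summing that pair directly avoids differentiating an infinite series. The terms are
  \<open>O(k\<^sup>3 4\<^sup>-\<^sup>k)\<close> (\<open>wzF'_bound\<close> and \<open>wzG'_bound\<close>), so the double sum can be rearranged, which gives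
  \<open>accelerated_inverse_cube_sums\<close>: the derivatives \<open>F\<^sub>k'(x)\<close> sum to \<open>-2/d\<close> times the
  sum of \<open>1/(x + n)\<^sup>3 - 1/(y + n)\<^sup>3\<close>.

  For \<open>x = d = 1/3\<close> the term \<open>F\<^sub>k'(x)\<close> is twice the term of index \<open>k + 1\<close> in the theorem, and the sum of
  cubes is of the form \<open>1/(x + n)\<^sup>3 - 1/(1 - x + n)\<^sup>3\<close>, which the second derivative of the
  cotangent evaluates; it is \<open>4 \<pi>\<^sup>3 / (3 \<surd>3)\<close>.
\<close>

section \<open>Summation of WZ pairs and derivatives of identities\<close>

text \<open>
  Summing the relation over \<open>k\<close> telescopes on the right, so the row sums of \<open>f\<close> differ by \<open>g n 0\<close>
  from one row to the next. The bound \<open>M\<close> dominates all rows at once, so by Tannery's theorem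
  the row sums tend to \<open>0\<close>, and telescoping in \<open>n\<close> finishes the proof.
\<close>
lemma wz_sums:
  fixes f g :: "nat \<Rightarrow> nat \<Rightarrow> real"
  assumes wz: "\<And>n k. f n k - f (Suc n) k = g n k - g n (Suc k)"
    and g_lim: "\<And>n. (\<lambda>k. g n k) \<longlonglongrightarrow> 0"
    and f_lim: "\<And>k. (\<lambda>n. f n k) \<longlonglongrightarrow> 0"
    and f_bound: "\<And>n k. \<bar>f n k\<bar> \<le> M k" and M: "summable M"
    and g_sums: "(\<lambda>n. g n 0) sums L"
  shows "f 0 sums L"
proof -
  have f_summable: "summable (f n)" for n
    using summable_comparison_test'[OF M, of 0 "f n"] f_bound by simp
  have "(\<lambda>k. f n k - f (Suc n) k) sums (g n 0)" for n
    unfolding wz using telescope_sums'[OF g_lim[of n]] by simp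
  hence step: "suminf (f n) - suminf (f (Suc n)) = g n 0" for n
    using sums_diff[OF summable_sums[OF f_summable] summable_sums[OF f_summable]]
      sums_unique2 by blast
  have "(\<lambda>n. suminf (f n)) \<longlonglongrightarrow> (\<Sum>k. 0)"
    using tannerys_theorem[of "\<lambda>k n. f n k" "\<lambda>_. 0" sequentially M] f_lim f_bound M
    by (simp add: case_prod_unfold)
  from telescope_sums'[OF this] have "(\<lambda>n. g n 0) sums suminf (f 0)"
    by (simp add: step)
  with g_sums have "suminf (f 0) = L" using sums_unique2 by blast
  thus ?thesis using f_summable[of 0] by (simp add: sums_iff)
qed

lemma derivs_eq_on_open:
  fixes f g :: "real \<Rightarrow> real"
  assumes "open S" "x \<in> S" "\<And>t. t \<in> S \<Longrightarrow> f t = g t"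
    and "(f has_real_derivative f') (at x)" "(g has_real_derivative g') (at x)"
  shows "f' = g'"
  using assms DERIV_unique has_field_derivative_transform_within_open by blast

section \<open>The WZ pair\<close>

text \<open>
  The pair depends on \<open>x\<close> and \<open>y = x + d\<close>. Keeping \<open>d\<close> fixed means that differentiation in \<open>x\<close> moves both
  bases at once, while the coefficients, which involve only \<open>d\<close>, stay constant.
\<close>
definition wz_coeff :: "real \<Rightarrow> nat \<Rightarrow> real" where
  "wz_coeff d k = (-1) ^ k * fact k ^ 4 * pochhammer (1 + d) k * pochhammer (1 - d) k / fact (2 * k + 1)"

definition wz_recip :: "real \<Rightarrow> nat \<Rightarrow> real \<Rightarrow> real" where
  "wz_recip d k x = 1 / (pochhammer x (Suc k) * pochhammer (x + d) (Suc k)) ^ 2"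

text \<open>The logarithmic derivative of \<open>wz_recip\<close> is \<open>-2\<close> times this sum.\<close>
definition recip_sum :: "real \<Rightarrow> nat \<Rightarrow> real \<Rightarrow> real" where
  "recip_sum d k x = (\<Sum>j\<le>k. 1 / (x + real j) + 1 / (x + d + real j))"

text \<open>
  Clearing denominators in the WZ equation leaves a difference equation for this polynomial. Comparing leading
  terms in \<open>x\<close> shows that its solution is monic quadratic in \<open>x\<close>, and at \<open>x = 0\<close> and \<open>y = 0\<close> the equation
  degenerates and gives two values, which determine it.
\<close>
definition wz_num :: "real \<Rightarrow> nat \<Rightarrow> real \<Rightarrow> real" where
  "wz_num d k x = x * (x + d) + (3 * real k + 1) * (2 * x + d) / 2 + (5 * real k ^ 2 + 4 * real k + 1) / 2"

definition wzF :: "real \<Rightarrow> nat \<Rightarrow> real \<Rightarrow> real" where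
  "wzF d k x = wz_coeff d k * wz_num d k x * wz_recip d k x"

definition wzG :: "real \<Rightarrow> nat \<Rightarrow> real \<Rightarrow> real" where
  "wzG d k x = wz_coeff d k * (2 * real k + 1) * (2 * x + d + real k) * wz_recip d k x"

text \<open>
  The derivatives of \<open>wzF\<close> and \<open>wzG\<close> are given in closed form because both the estimates and the
  comparison with harmonic numbers refer to \<open>recip_sum\<close>.
\<close>
definition wzF' :: "real \<Rightarrow> nat \<Rightarrow> real \<Rightarrow> real" where
  "wzF' d k x = wz_coeff d k * wz_recip d k x *
     (2 * x + d + 3 * real k + 1 - 2 * wz_num d k x * recip_sum d k x)"

definition wzG' :: "real \<Rightarrow> nat \<Rightarrow> real \<Rightarrow> real" where
  "wzG' d k x = wz_coeff d k * wz_recip d k x *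
     ((2 * real k + 1) * (2 - 2 * (2 * x + d + real k) * recip_sum d k x))"

lemma wz_coeff_Suc:
  "wz_coeff d (Suc k) = - wz_coeff d k * (real k + 1) ^ 4 * (real k + 1 + d) * (real k + 1 - d) /
     ((2 * real k + 2) * (2 * real k + 3))"
proof -
  have "fact (2 * Suc k + 1) = (fact (2 * k + 1) :: real) * ((2 * real k + 2) * (2 * real k + 3))"
    by (simp add: algebra_simps)
  moreover have "fact (Suc k) ^ 4 = (fact k :: real) ^ 4 * (real k + 1) ^ 4"
    by (simp add: power_mult_distrib mult.commute add.commute)
  ultimately show ?thesis
    unfolding wz_coeff_def pochhammer_Suc power_Suc by (simp only:) (simp add: add_ac mult_ac)
qed

lemma wz_recip_Suc:
  "wz_recip d (Suc k) x = wz_recip d k x / ((x + real k + 1) * (x + d + real k + 1)) ^ 2"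
  unfolding wz_recip_def pochhammer_Suc[of _ "Suc k"] by (simp add: power_mult_distrib add_ac mult_ac)

lemma wz_recip_shift:
  assumes "x > 0" "x + d > 0"
  shows "wz_recip d k (x + 1) =
    wz_recip d k x * (x * (x + d)) ^ 2 / ((x + real k + 1) * (x + d + real k + 1)) ^ 2"
proof -
  have shift: "pochhammer (z + 1) (Suc k) = pochhammer z (Suc k) * (z + real k + 1) / z"
    if "z > 0" for z :: real
    using that pochhammer_rec[of z "Suc k"] pochhammer_Suc[of z "Suc k"]
    by (simp add: field_simps)
  have "x + 1 + d = (x + d) + 1" by simp
  then show ?thesis
    unfolding wz_recip_def using assms by (simp only: shift) (simp add: power_divide power_mult_distrib)
qed

text \<open>
  All four terms are \<open>wz_coeff d k * wz_recip d k x\<close> times a rational function of \<open>k\<close>, \<open>x\<close> and \<open>d\<close>, so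
  that the equation reduces to the polynomial identity \<open>key\<close>.
\<close>
lemma wz_identity:
  assumes "x > 0" "x + d > 0"
  shows "wzF d k x - wzF d k (x + 1) = wzG d k x - wzG d (Suc k) x"
proof -
  define A where "A = x + real k + 1"
  define B where "B = x + d + real k + 1"
  define K where "K = real k"
  have nz: "A \<noteq> 0" "B \<noteq> 0" "K + 1 \<noteq> 0" "2 * K + 3 \<noteq> 0"
    using assms by (auto simp: A_def B_def K_def)
  have key: "wz_num d k x * (A * B)^2 - wz_num d k (x + 1) * (x * (x + d))^2
     = (2 * K + 1) * (2 * x + d + K) * (A*B)^2
       + (K + 1)^3 * (K + 1 + d) * (K + 1 - d) * (2 * x + d + K + 1) / 2"
    unfolding wz_num_def A_def B_def K_def by (simp add: field_simps) algebra
  have c: "wz_coeff d (Suc k) * (2 * K + 3) = - wz_coeff d k * (K+1)^3 * (K + 1 + d) * (K + 1 - d) / 2"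
    unfolding wz_coeff_Suc K_def[symmetric] using nz by (simp add: divide_simps) algebra
  have "wzF d k x - wzF d k (x + 1) = wz_coeff d k * wz_recip d k x / (A * B)^2 *
      (wz_num d k x * (A * B)^2 - wz_num d k (x + 1) * (x * (x + d))^2)"
    unfolding wzF_def wz_recip_shift[OF assms] A_def[symmetric] B_def[symmetric]
    using nz by (simp add: divide_simps) algebra
  also have "\<dots> = wz_coeff d k * wz_recip d k x * (2 * K + 1) * (2 * x + d + K) -
       (- wz_coeff d k * (K+1)^3 * (K + 1 + d) * (K + 1 - d) / 2) * (2 * x + d + K + 1) * (wz_recip d k x / (A * B)^2)"
    unfolding key using nz by (simp add: divide_simps) algebra
  also have "\<dots> = wzG d k x - wzG d (Suc k) x"
    unfolding c[symmetric] wzG_def wz_recip_Suc A_def[symmetric] B_def[symmetric]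
    by (simp add: K_def algebra_simps)
  finally show ?thesis .
qed

section \<open>The differentiated pair\<close>

text \<open>
  Dividing by \<open>(t + c)\<^sup>2\<close> adds \<open>-2/(t + c)\<close> to a logarithmic derivative. Two such steps
  lead from \<open>wz_recip d k\<close> to \<open>wz_recip d (Suc k)\<close>, one for each base.
\<close>
lemma log_deriv_divide_square:
  fixes f :: "real \<Rightarrow> real"
  assumes "(f has_real_derivative - 2 * f x * l) (at x)" "x + c \<noteq> 0"
  shows "((\<lambda>t. f t / (t + c) ^ 2) has_real_derivative - 2 * (f x / (x + c) ^ 2) * (l + 1 / (x + c))) (at x)"
  using assms(2)
  by (auto intro!: derivative_eq_intros assms(1) simp: divide_simps power2_eq_square) algebra

lemma wz_recip_deriv:
  assumes "x > 0" "x + d > 0"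
  shows "(wz_recip d k has_real_derivative - 2 * wz_recip d k x * recip_sum d k x) (at x)"
proof (induction k)
  case 0
  have "((\<lambda>t. 1 / (t + 0) ^ 2 / (t + d) ^ 2) has_real_derivative
      - 2 * (1 / (x + 0) ^ 2 / (x + d) ^ 2) * (0 + 1 / (x + 0) + 1 / (x + d))) (at x)"
    using assms by (intro log_deriv_divide_square) auto
  moreover have "wz_recip d 0 = (\<lambda>t. 1 / (t + 0) ^ 2 / (t + d) ^ 2)"
    by (simp add: wz_recip_def fun_eq_iff power_mult_distrib)
  ultimately show ?case by (simp add: recip_sum_def)
next
  case (Suc k)
  have "((\<lambda>t. wz_recip d k t / (t + real (Suc k)) ^ 2 / (t + (d + real (Suc k))) ^ 2) has_real_derivative
      - 2 * (wz_recip d k x / (x + real (Suc k)) ^ 2 / (x + (d + real (Suc k))) ^ 2) *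
        (recip_sum d k x + 1 / (x + real (Suc k)) + 1 / (x + (d + real (Suc k))))) (at x)"
    using assms by (intro log_deriv_divide_square Suc) auto
  moreover have "wz_recip d (Suc k) = (\<lambda>t. wz_recip d k t / (t + real (Suc k)) ^ 2 / (t + (d + real (Suc k))) ^ 2)"
    by (simp add: wz_recip_Suc fun_eq_iff power_mult_distrib add_ac)
  moreover have "recip_sum d (Suc k) x =
      recip_sum d k x + 1 / (x + real (Suc k)) + 1 / (x + (d + real (Suc k)))"
    by (simp add: recip_sum_def add_ac)
  ultimately show ?case by simp
qed

lemma wz_num_deriv: "(wz_num d k has_real_derivative 2 * x + d + 3 * real k + 1) (at x)"
  unfolding wz_num_def[abs_def] by (auto intro!: derivative_eq_intros simp: field_simps)

lemma wzF_deriv: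
  assumes "x > 0" "x + d > 0"
  shows "(wzF d k has_real_derivative wzF' d k x) (at x)"
  unfolding wzF_def[abs_def] wzF'_def
  by (auto intro!: derivative_eq_intros wz_num_deriv wz_recip_deriv assms simp: algebra_simps)

lemma wzG_deriv:
  assumes "x > 0" "x + d > 0"
  shows "(wzG d k has_real_derivative wzG' d k x) (at x)"
  unfolding wzG_def[abs_def] wzG'_def
  by (auto intro!: derivative_eq_intros wz_recip_deriv assms simp: algebra_simps)

text \<open>
  The WZ equation holds on the whole open set where both bases are positive, so both sides have the same derivative.
\<close>
lemma wz_identity_deriv:
  assumes "x > 0" "x + d > 0"
  shows "wzF' d k x - wzF' d k (x + 1) = wzG' d k x - wzG' d (Suc k) x"
proof (rule derivs_eq_on_open)
  show "open {max 0 (- d)<..}" by simp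
  show "x \<in> {max 0 (- d)<..}" using assms by auto
  show "wzF d k t - wzF d k (t + 1) = wzG d k t - wzG d (Suc k) t" if "t \<in> {max 0 (- d)<..}" for t
    using that by (intro wz_identity) auto
  have "((\<lambda>t. wzF d k (t + 1)) has_real_derivative wzF' d k (x + 1)) (at x)"
    using assms DERIV_shift[of "wzF d k" _ x 1] wzF_deriv[of "x + 1" d k] by simp
  then show "((\<lambda>t. wzF d k t - wzF d k (t + 1)) has_real_derivative
      (wzF' d k x - wzF' d k (x + 1))) (at x)"
    by (intro DERIV_diff wzF_deriv assms)
  show "((\<lambda>t. wzG d k t - wzG d (Suc k) t) has_real_derivative
      (wzG' d k x - wzG' d (Suc k) x)) (at x)"
    by (intro DERIV_diff wzG_deriv assms)
qed

section \<open>Geometric decay\<close>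

text \<open>
  The quotient of consecutive terms is at most \<open>1/4\<close>: the factors \<open>k + 1 \<plusminus> d\<close> of the numerator have product at most
  \<open>(k + 1)\<^sup>2\<close>, and \<open>x + k + 1\<close> and \<open>y + k + 1\<close> in the denominator are each at least \<open>k + 1\<close>,
  while \<open>(2k + 2)(2k + 3) \<ge> 4 (k + 1)\<^sup>2\<close>.
  The condition \<open>d \<le> 1\<close> keeps the product of \<open>k + 1 + d\<close> and \<open>k + 1 - d\<close> nonnegative from \<open>k = 0\<close> on.
\<close>
lemma coeff_recip_bound:
  assumes "0 \<le> d" "d \<le> 1" "x > 0"
  shows "\<bar>wz_coeff d k * wz_recip d k x\<bar> \<le> (1 / 4) ^ k / (x * (x + d)) ^ 2"
proof (induction k)
  case 0
  then show ?case by (simp add: wz_coeff_def wz_recip_def)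
next
  case (Suc k)
  define K where "K = real k"
  have K: "K \<ge> 0" by (simp add: K_def)
  define r where "r = (K + 1) ^ 4 * (K + 1 + d) * (K + 1 - d) /
     ((2 * K + 2) * (2 * K + 3)) / ((x + K + 1) * (x + d + K + 1)) ^ 2"
  have step: "wz_coeff d (Suc k) * wz_recip d (Suc k) x = - (wz_coeff d k * wz_recip d k x) * r"
    unfolding wz_coeff_Suc wz_recip_Suc r_def K_def by simp
  have r0: "r \<ge> 0" unfolding r_def using assms K by simp
  have "(K + 1)^4 * (K + 1 + d) * (K + 1 - d) * 4
      = ((2*K+2) * (2*K+2)) * (K+1)^2 * ((K+1+d) * (K+1-d))"
    by algebra
  also have "\<dots> \<le> ((2*K+2) * (2*K+3)) * (x + K + 1)^2 * ((x + d + K + 1)^2)"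
  proof -
    have "(K+1+d) * (K+1-d) \<le> (x + d + K + 1) * (x + d + K + 1)"
      using assms K by (intro mult_mono) auto
    then show ?thesis
      using assms K by (intro mult_mono power_mono) (auto simp: power2_eq_square)
  qed
  finally have r4: "r \<le> 1 / 4"
    unfolding r_def using assms K by (simp add: divide_simps power_mult_distrib mult_ac)
  have "\<bar>wz_coeff d (Suc k) * wz_recip d (Suc k) x\<bar> = r * \<bar>wz_coeff d k * wz_recip d k x\<bar>"
    unfolding step using r0 by (simp add: abs_mult)
  also have "\<dots> \<le> (1 / 4) * ((1 / 4) ^ k / (x * (x + d)) ^ 2)"
    using r0 r4 Suc by (intro mult_mono) auto
  finally show ?case by simp
qed

lemma recip_sum_bounds:
  assumes "0 \<le> d" "x > 0"
  shows "0 \<le> recip_sum d k x" "recip_sum d k x \<le> 2 * (real k + 1) / x"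
proof -
  show "0 \<le> recip_sum d k x"
    unfolding recip_sum_def using assms by (intro sum_nonneg add_nonneg_nonneg) auto
  have "recip_sum d k x \<le> (\<Sum>j\<le>k. 2 / x)"
    unfolding recip_sum_def
  proof (intro sum_mono)
    fix j
    have "1 / (x + real j) \<le> 1 / x" "1 / (x + d + real j) \<le> 1 / x"
      using assms by (auto intro!: divide_left_mono)
    then show "1 / (x + real j) + 1 / (x + d + real j) \<le> 2 / x" by simp
  qed
  then show "recip_sum d k x \<le> 2 * (real k + 1) / x" by (simp add: field_simps)
qed

text \<open>
  The constant depends only on a lower bound \<open>a\<close> of \<open>x\<close>, and the factor \<open>1/(x (x + d))\<close> decreases to \<open>0\<close>
  in \<open>x\<close>. Applied to \<open>x + n\<close>, the bound therefore gives both a majorant independent of \<open>n\<close> and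
  convergence to \<open>0\<close> as \<open>n\<close> grows.
\<close>
lemma wzF'_bound:
  assumes d: "0 \<le> d" "d \<le> 1" and a: "a > 0" "a \<le> x"
  shows "\<bar>wzF' d k x\<bar> \<le> 3 * (1 + 1 / a) ^ 2 * (1 + 4 / a) * (real k + 1) ^ 3 * (1 / 4) ^ k / (x * (x + d))"
proof -
  define s where "s = 1 / a"
  define K where "K = real k + 1"
  define P where "P = x * (x + d)"
  have x: "x > 0" using a by simp
  have s0: "s > 0" and K1: "K \<ge> 1" and P0: "P > 0" using a d x by (auto simp: s_def K_def P_def)
  have xs: "1 \<le> s * x" "1 \<le> s * (x + d)"
    using a d by (auto simp: s_def field_simps)
  \<comment> \<open>Every monomial of the numerator is compared with \<open>P\<close>, which cancels one of the two factors
    \<open>P\<close> in \<open>coeff_recip_bound\<close>.\<close>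
  have lin: "2 * x + d \<le> 2 * s * P"
  proof -
    have "1 * (x + d) \<le> (s * x) * (x + d)" "x * 1 \<le> x * (s * (x + d))"
      using xs x d by (intro mult_right_mono mult_left_mono; simp)+
    then show ?thesis unfolding P_def by (simp add: algebra_simps)
  qed
  have const: "1 \<le> s^2 * P"
    using mult_mono[OF xs(1) xs(2)] xs x s0 unfolding P_def by (simp add: power2_eq_square mult_ac)
  have KK: "K \<le> K^2" using K1 by (simp add: power2_eq_square)
  have num_le: "wz_num d k x \<le> P * (3 * (1 + s)^2) * K^2"
  proof -
    have "wz_num d k x \<le> P + 3 * K / 2 * (2 * x + d) + 5 / 2 * K^2"
      unfolding wz_num_def K_def P_def using x d by (simp add: field_simps power2_eq_square)
    also have "\<dots> \<le> P * K^2 + 3 * K^2 / 2 * (2 * s * P) + 5 / 2 * K^2 * (s^2 * P)"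
    proof (intro add_mono)
      show "P \<le> P * K^2" using K1 P0 by (simp)
      show "3 * K / 2 * (2 * x + d) \<le> 3 * K^2 / 2 * (2 * s * P)"
        using KK lin x d K1 by (intro mult_mono) auto
      show "5 / 2 * K^2 \<le> 5 / 2 * K^2 * (s^2 * P)"
        using mult_left_mono[OF const, of "5 / 2 * K^2"] by simp
    qed
    also have "\<dots> = P * (1 + 3 * s + 5/2 * s^2) * K^2" by (simp add: algebra_simps)
    also have "\<dots> \<le> P * (3 * (1 + s)^2) * K^2"
      using P0 s0 by (intro mult_right_mono mult_left_mono) (auto simp: power2_eq_square algebra_simps)
    finally show ?thesis .
  qed
  have num0: "wz_num d k x \<ge> 0" unfolding wz_num_def using x d by simp
  have num'_le: "2 * x + d + 3 * real k + 1 \<le> P * (3 * (1 + s)^2) * K^3"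
  proof -
    have "2 * x + d + 3 * real k + 1 \<le> 2 * s * P + 3 * K * (s^2 * P)"
    proof -
      have "3 * K \<le> 3 * K * (s^2 * P)" using mult_left_mono[OF const, of "3 * K"] K1 by simp
      moreover have "real k = K - 1" by (simp add: K_def)
      ultimately show ?thesis using lin by linarith
    qed
    also have "\<dots> \<le> K * (2 * s * P) + K * (3 * s^2 * P)"
      using K1 s0 P0 by (simp add: algebra_simps)
    also have "\<dots> = P * (2 * s + 3 * s^2) * K" by (simp add: algebra_simps)
    also have "\<dots> \<le> P * (3 * (1 + s)^2) * K^3"
    proof -
      have "K ^ 1 \<le> K ^ 3" using K1 by (intro power_increasing) auto
      then show ?thesis
        using P0 s0 K1 by (intro mult_mono) (auto simp: power2_eq_square algebra_simps)
    qed
    finally show ?thesis .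
  qed
  have l: "0 \<le> recip_sum d k x" "recip_sum d k x \<le> 2 * K * s"
  proof -
    show "0 \<le> recip_sum d k x" using recip_sum_bounds d x by blast
    have "2 * K / x \<le> 2 * K * s" using a x K1 by (simp add: s_def divide_left_mono)
    then show "recip_sum d k x \<le> 2 * K * s" using recip_sum_bounds(2)[OF d(1) x, of k] by (simp add: K_def)
  qed
  have "\<bar>2 * x + d + 3 * real k + 1 - 2 * wz_num d k x * recip_sum d k x\<bar>
      \<le> P * (3 * (1 + s)^2) * K^3 + 2 * (P * (3 * (1 + s)^2) * K^2) * (2 * K * s)"
  proof -
    have "2 * wz_num d k x * recip_sum d k x \<le> 2 * (P * (3 * (1 + s)^2) * K^2) * (2 * K * s)"
      using num_le num0 l P0 s0 K1 by (intro mult_mono) auto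
    moreover have "2 * wz_num d k x * recip_sum d k x \<ge> 0" using num0 l by simp
    moreover have "2 * x + d + 3 * real k + 1 \<ge> 0" using x d by simp
    ultimately show ?thesis using num'_le by linarith
  qed
  also have "\<dots> = P * (3 * (1 + s)^2 * (1 + 4 * s) * K^3)"
    by (simp add: algebra_simps power3_eq_cube power2_eq_square)
  finally have "\<bar>wzF' d k x\<bar> \<le> ((1 / 4) ^ k / P ^ 2) * (P * (3 * (1 + s)^2 * (1 + 4 * s) * K^3))"
    unfolding wzF'_def abs_mult[of "wz_coeff d k * wz_recip d k x"]
    using coeff_recip_bound[OF d x, of k] P0 by (intro mult_mono) (auto simp: P_def)
  also have "\<dots> = 3 * (1 + s)^2 * (1 + 4 * s) * K^3 * (1 / 4) ^ k / P"
    using P0 by (simp add: power2_eq_square)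
  finally show ?thesis by (simp add: s_def K_def P_def)
qed

lemma wzG'_bound:
  assumes d: "0 \<le> d" "d \<le> 1" and x: "x > 0"
  shows "\<bar>wzG' d k x\<bar> \<le>
    (4 + 8 * (2 * x + d + 1) / x) / (x * (x + d)) ^ 2 * ((real k + 1) ^ 3 * (1 / 4) ^ k)"
proof -
  define K where "K = real k + 1"
  have K1: "K \<ge> 1" by (simp add: K_def)
  have l: "0 \<le> recip_sum d k x" "recip_sum d k x \<le> 2 * K / x"
    using recip_sum_bounds[OF d(1) x, of k] by (auto simp: K_def)
  have q: "2 * x + d + real k \<le> (2 * x + d + 1) * K"
    using x d by (simp add: K_def algebra_simps)
  have prod: "2 * (2 * x + d + real k) * recip_sum d k x \<le> 2 * ((2 * x + d + 1) * K) * (2 * K / x)"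
    using q l x d K1 by (intro mult_mono) auto
  have "\<bar>2 - 2 * (2 * x + d + real k) * recip_sum d k x\<bar> \<le> 2 + 2 * ((2 * x + d + 1) * K) * (2 * K / x)"
  proof -
    have "2 * (2 * x + d + real k) * recip_sum d k x \<ge> 0" using x d l by simp
    with prod show ?thesis by linarith
  qed
  also have "\<dots> \<le> (2 + 4 * (2 * x + d + 1) / x) * K^2"
  proof -
    have "2 * ((2 * x + d + 1) * K) * (2 * K / x) = 4 * (2 * x + d + 1) / x * K^2"
      by (simp add: power2_eq_square)
    then show ?thesis using one_le_power[OF K1, of 2] unfolding distrib_right by linarith
  qed
  finally have "\<bar>(2 * real k + 1) * (2 - 2 * (2 * x + d + real k) * recip_sum d k x)\<bar>
      \<le> (2 * K) * ((2 + 4 * (2 * x + d + 1) / x) * K^2)"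
    unfolding abs_mult using K1 by (intro mult_mono) (auto simp: K_def)
  also have "\<dots> = (4 + 8 * (2 * x + d + 1) / x) * K^3"
    by (simp add: algebra_simps power3_eq_cube power2_eq_square add_divide_distrib)
  finally have "\<bar>wzG' d k x\<bar> \<le> ((1 / 4) ^ k / (x * (x + d)) ^ 2) * ((4 + 8 * (2 * x + d + 1) / x) * K^3)"
    unfolding wzG'_def abs_mult[of "wz_coeff d k * wz_recip d k x"]
    using coeff_recip_bound[OF d x, of k] by (intro mult_mono) auto
  then show ?thesis by (simp add: K_def mult_ac)
qed

lemma summable_cubic_quarter: "summable (\<lambda>k. (real k + 1) ^ 3 * (1 / 4) ^ k)"
  \<comment> \<open>From \<open>k = 4\<close> on, \<open>(k + 2)/(k + 1) \<le> 6/5\<close>, whose cube is below \<open>2\<close>.\<close>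
proof (rule summable_ratio_test[where c = "1 / 2" and N = 4])
  fix k :: nat
  assume k: "k \<ge> 4"
  have "(real k + 2) ^ 3 \<le> (6 / 5 * (real k + 1)) ^ 3"
    using k by (intro power_mono) auto
  also have "\<dots> \<le> 2 * (real k + 1) ^ 3"
  proof -
    have "(6 / 5 * z) ^ 3 \<le> 2 * z ^ 3" if "z \<ge> 0" for z :: real
      using that by (simp add: power_mult_distrib power_divide)
    from this[of "real k + 1"] show ?thesis by simp
  qed
  finally have "(real k + 2) ^ 3 \<le> 2 * (real k + 1) ^ 3" .
  then show "norm ((real (Suc k) + 1) ^ 3 * (1 / 4) ^ Suc k) \<le> 1 / 2 * norm ((real k + 1) ^ 3 * (1 / 4) ^ k :: real)"
    by (simp add: abs_mult add.commute)
qed simp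

section \<open>Acceleration of the inverse cube series\<close>

text \<open>
  This is the sum of the differentiated pair over the grid of points \<open>x + n\<close>: \<open>wzG' d 0\<close> is the derivative of
  \<open>(1/x\<^sup>2 - 1/(x + d)\<^sup>2)/d\<close>.
\<close>
theorem accelerated_inverse_cube_sums:
  fixes d x :: real
  assumes d: "0 < d" "d \<le> 1" and x: "x > 0"
    and L: "(\<lambda>n. 1 / (x + real n) ^ 3 - 1 / (x + d + real n) ^ 3) sums L"
  shows "(\<lambda>k. wzF' d k x) sums (- 2 * L / d)"
proof -
  have d': "0 \<le> d" using d by simp
  have pos: "x + real n > 0" for n using x by (simp add: add_pos_nonneg)
  define C where "C = 3 * (1 + 1 / x) ^ 2 * (1 + 4 / x)"
  have C0: "C \<ge> 0" using x by (simp add: C_def)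
  have bound: "\<bar>wzF' d k (x + real n)\<bar> \<le>
      C * (real k + 1) ^ 3 * (1 / 4) ^ k / ((x + real n) * (x + real n + d))" for n k
    using wzF'_bound[OF d' d(2) x, of "x + real n" k] by (simp add: C_def)
  have "(\<lambda>k. wzF' d k (x + real 0)) sums (- 2 / d * L)"
  proof (rule wz_sums[where f = "\<lambda>n k. wzF' d k (x + real n)" and g = "\<lambda>n k. wzG' d k (x + real n)"
        and M = "\<lambda>k. C / (x * (x + d)) * ((real k + 1) ^ 3 * (1 / 4) ^ k)"])
    fix n k
    show "wzF' d k (x + real n) - wzF' d k (x + real (Suc n)) =
        wzG' d k (x + real n) - wzG' d (Suc k) (x + real n)"
      using wz_identity_deriv[of "x + real n" d k] pos[of n] d by (simp add: add_ac)
    have "C * (real k + 1) ^ 3 * (1 / 4) ^ k / ((x + real n) * (x + real n + d))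
        \<le> C * (real k + 1) ^ 3 * (1 / 4) ^ k / (x * (x + d))"
      using x d C0 by (intro divide_left_mono mult_mono mult_pos_pos) (auto intro: add_pos_nonneg)
    with bound[of k n] show "\<bar>wzF' d k (x + real n)\<bar> \<le> C / (x * (x + d)) * ((real k + 1) ^ 3 * (1 / 4) ^ k)"
      by (simp add: mult.assoc)
  next
    fix n
    show "(\<lambda>k. wzG' d k (x + real n)) \<longlonglongrightarrow> 0"
    proof (rule tendsto_rabs_zero_cancel, rule tendsto_sandwich)
      show "\<forall>\<^sub>F k in sequentially. 0 \<le> \<bar>wzG' d k (x + real n)\<bar>" by simp
      show "\<forall>\<^sub>F k in sequentially. \<bar>wzG' d k (x + real n)\<bar> \<le>
        (4 + 8 * (2 * (x + real n) + d + 1) / (x + real n)) / ((x + real n) * (x + real n + d)) ^ 2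
          * ((real k + 1) ^ 3 * (1 / 4) ^ k)"
        using wzG'_bound[OF d' d(2) pos] by simp
      show "(\<lambda>k. (4 + 8 * (2 * (x + real n) + d + 1) / (x + real n)) / ((x + real n) * (x + real n + d)) ^ 2
          * ((real k + 1) ^ 3 * (1 / 4) ^ k)) \<longlonglongrightarrow> 0"
        by (intro tendsto_mult_right_zero summable_LIMSEQ_zero summable_cubic_quarter)
    qed simp
  next
    fix k
    show "(\<lambda>n. wzF' d k (x + real n)) \<longlonglongrightarrow> 0"
    proof (rule tendsto_rabs_zero_cancel, rule tendsto_sandwich)
      show "\<forall>\<^sub>F n in sequentially. 0 \<le> \<bar>wzF' d k (x + real n)\<bar>" by simp
      show "\<forall>\<^sub>F n in sequentially. \<bar>wzF' d k (x + real n)\<bar> \<le>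
        C * (real k + 1) ^ 3 * (1 / 4) ^ k / ((x + real n) * (x + real n + d))"
        using bound by simp
      show "(\<lambda>n. C * (real k + 1) ^ 3 * (1 / 4) ^ k / ((x + real n) * (x + real n + d))) \<longlonglongrightarrow> 0"
      proof (rule tendsto_divide_0[OF tendsto_const], rule filterlim_at_top_imp_at_infinity,
          rule filterlim_at_top_mult_at_top)
        show "filterlim (\<lambda>n. x + real n) at_top sequentially"
          by (intro filterlim_tendsto_add_at_top[OF tendsto_const] filterlim_real_sequentially)
        have "filterlim (\<lambda>n. (x + d) + real n) at_top sequentially"
          by (intro filterlim_tendsto_add_at_top[OF tendsto_const] filterlim_real_sequentially)
        then show "filterlim (\<lambda>n. x + real n + d) at_top sequentially"
          by (simp add: add_ac)
      qed
    qed simp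
  next
    show "summable (\<lambda>k. C / (x * (x + d)) * ((real k + 1) ^ 3 * (1 / 4) ^ k))"
      by (intro summable_mult summable_cubic_quarter)
  next
    have "wzG' d 0 (x + real n) = - 2 / d * (1 / (x + real n) ^ 3 - 1 / (x + d + real n) ^ 3)" for n
    proof -
      define z where "z = x + real n"
      define w where "w = z + d"
      have nz: "z \<noteq> 0" "w \<noteq> 0" "d \<noteq> 0" using pos[of n] d by (auto simp: z_def w_def)
      have "wzG' d 0 z = (2 - 2 * (z + w) * (1 / z + 1 / w)) / (z * w) ^ 2"
        by (simp add: wzG'_def wz_coeff_def wz_recip_def recip_sum_def w_def)
      also have "\<dots> = - 2 * (z ^ 2 + z * w + w ^ 2) / (z * w) ^ 3"
        using nz by (simp add: field_simps eval_nat_numeral)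
      also have "z ^ 2 + z * w + w ^ 2 = (w ^ 3 - z ^ 3) / d"
        using nz(3) unfolding w_def by (simp add: field_simps eval_nat_numeral)
      also have "- 2 * ((w ^ 3 - z ^ 3) / d) / (z * w) ^ 3 = - 2 / d * (1 / z ^ 3 - 1 / w ^ 3)"
        using nz by (simp add: divide_simps)
      finally have "wzG' d 0 z = - 2 / d * (1 / z ^ 3 - 1 / (z + d) ^ 3)"
        unfolding w_def .
      then show ?thesis by (simp add: z_def add_ac)
    qed
    then show "(\<lambda>n. wzG' d 0 (x + real n)) sums (- 2 / d * L)"
      using sums_mult[OF L, of "- 2 / d"] by simp
  qed
  then show ?thesis by simp
qed

section \<open>The inverse cube series at reflected arguments\<close>

lemma Gamma_reflection_real:
  fixes x :: real
  shows "Gamma x * Gamma (1 - x) = pi / sin (pi * x)"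
proof -
  have "complex_of_real (Gamma x * Gamma (1 - x)) = of_real (pi / sin (pi * x))"
  proof -
    have "1 - complex_of_real x = of_real (1 - x)" by simp
    then show ?thesis
      using Gamma_reflection_complex[of "of_real x"]
      by (simp only: Gamma_complex_of_real sin_of_real flip: of_real_mult of_real_divide)
  qed
  then show ?thesis by (simp only: of_real_eq_iff)
qed

text \<open>
  This is the third derivative of the logarithm of the reflection formula for \<open>\<Gamma>\<close>; the first one is the
  reflection formula for the digamma function, whose right-hand side is \<open>- \<pi> cot (\<pi> x)\<close>.
\<close>
lemma Polygamma_2_reflection:
  fixes x :: real
  assumes x: "0 < x" "x < 1"
  shows "Polygamma 2 (1 - x) - Polygamma 2 x = 2 * pi ^ 3 * cos (pi * x) / sin (pi * x) ^ 3"
proof -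
  define S :: "real set" where "S = {0<..<1}"
  have S: "open S" "\<And>t. t \<in> S \<longleftrightarrow> 0 < t \<and> t < 1" by (auto simp: S_def)
  have sin: "sin (pi * t) > 0" if "t \<in> S" for t
    using that by (intro sin_gt_zero) (auto simp: S)
  have nonint: "t \<notin> \<int>\<^sub>\<le>\<^sub>0" "1 - t \<notin> \<int>\<^sub>\<le>\<^sub>0" if "t \<in> S" for t
    using that by (auto simp: S elim!: nonpos_Ints_cases)
  have 0: "ln_Gamma t + ln_Gamma (1 - t) = ln pi - ln (sin (pi * t))" if t: "t \<in> S" for t
  proof -
    have "ln_Gamma t + ln_Gamma (1 - t) = ln (Gamma t * Gamma (1 - t))"
    proof -
      have "Gamma t > 0" "Gamma (1 - t) > 0" using t by (auto simp: S)
      then show ?thesis using t by (simp add: S ln_Gamma_real_pos ln_mult_pos)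
    qed
    also have "\<dots> = ln pi - ln (sin (pi * t))"
      using sin[OF t] by (simp add: Gamma_reflection_real ln_div)
    finally show ?thesis .
  qed
  have 1: "Digamma t - Digamma (1 - t) = - pi * cos (pi * t) / sin (pi * t)" if t: "t \<in> S" for t
    by (rule derivs_eq_on_open[OF S(1) t 0])
       (use t sin[OF t] in \<open>auto intro!: derivative_eq_intros simp: S\<close>)
  have 2: "Polygamma 1 t + Polygamma 1 (1 - t) = pi ^ 2 / sin (pi * t) ^ 2" if t: "t \<in> S" for t
  proof (rule derivs_eq_on_open[OF S(1) t 1])
    show "((\<lambda>t. Digamma t - Digamma (1 - t)) has_real_derivative Polygamma 1 t + Polygamma 1 (1 - t)) (at t)"
      using nonint[OF t] by (auto intro!: derivative_eq_intros)
    have "((\<lambda>t. - pi * cos (pi * t) / sin (pi * t)) has_real_derivative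
        (pi * pi * sin (pi * t) * sin (pi * t) + pi * pi * cos (pi * t) * cos (pi * t)) /
          sin (pi * t) ^ 2) (at t)"
      using sin[OF t] by (auto intro!: derivative_eq_intros simp: field_simps power2_eq_square)
    moreover have "pi * pi * sin (pi * t) * sin (pi * t) + pi * pi * cos (pi * t) * cos (pi * t) = pi ^ 2"
      using sin_cos_squared_add[of "pi * t"] by algebra
    ultimately show "((\<lambda>t. - pi * cos (pi * t) / sin (pi * t)) has_real_derivative
        pi ^ 2 / sin (pi * t) ^ 2) (at t)"
      by simp
  qed
  have 3: "Polygamma 2 t - Polygamma 2 (1 - t) = - 2 * pi ^ 3 * cos (pi * t) / sin (pi * t) ^ 3"
    if t: "t \<in> S" for t
  proof (rule derivs_eq_on_open[OF S(1) t 2])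
    show "((\<lambda>t. Polygamma 1 t + Polygamma 1 (1 - t)) has_real_derivative
        Polygamma 2 t - Polygamma 2 (1 - t)) (at t)"
      using nonint[OF t] by (auto intro!: derivative_eq_intros simp: numeral_2_eq_2)
    show "((\<lambda>t. pi ^ 2 / sin (pi * t) ^ 2) has_real_derivative
        - 2 * pi ^ 3 * cos (pi * t) / sin (pi * t) ^ 3) (at t)"
      using sin[OF t]
      by (auto intro!: derivative_eq_intros simp: divide_simps power2_eq_square power3_eq_cube)
  qed
  show ?thesis using 3[of x] x by (simp add: S)
qed

lemma inverse_cube_reflection_sums:
  fixes x :: real
  assumes x: "0 < x" "x < 1"
  shows "(\<lambda>n. 1 / (x + real n) ^ 3 - 1 / (1 - x + real n) ^ 3) sums
    (pi ^ 3 * cos (pi * x) / sin (pi * x) ^ 3)"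
proof -
  have "(\<lambda>n. 1 / (z + real n) ^ 3) sums (- Polygamma 2 z / 2)" if "z > 0" for z :: real
    using Polygamma_LIMSEQ[of z 2] that by (simp add: inverse_eq_divide numeral_3_eq_3)
  from sums_diff[OF this[of x] this[of "1 - x"]] x show ?thesis
    using Polygamma_2_reflection[OF x] by (simp add: diff_divide_distrib[symmetric])
qed

lemma inverse_cube_third_sums:
  "(\<lambda>n. 1 / (1/3 + real n) ^ 3 - 1 / (2/3 + real n) ^ 3) sums (4 * pi ^ 3 / (3 * sqrt 3))"
proof -
  have "pi ^ 3 * cos (pi * (1/3)) / sin (pi * (1/3)) ^ 3 = 4 * pi ^ 3 / (3 * sqrt 3)"
    by (simp add: cos_60 sin_60 power_divide power3_eq_cube)
  with inverse_cube_reflection_sums[of "1/3"] show ?thesis by simp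
qed

section \<open>The pair at one third\<close>

text \<open>
  The fractions \<open>3/(3j + 1)\<close> and \<open>3/(3j + 2)\<close> for \<open>j \<le> k\<close> are three times the part of \<open>H\<^bsub>3k+2\<^esub>\<close> with denominators prime
  to \<open>3\<close>; the remaining part, tripled, is \<open>H\<^sub>k\<close>.
\<close>
lemma recip_sum_third: "recip_sum (1/3) k (1/3) = 3 * harm (3 * k + 2) - harm k"
proof (induction k)
  case 0
  show ?case by (simp add: recip_sum_def harm_def numeral_2_eq_2 field_simps)
next
  case (Suc k)
  have "3 * Suc k + 2 = Suc (Suc (Suc (3 * k + 2)))" by simp
  then have h3: "harm (3 * Suc k + 2) = (harm (3 * k + 2) :: real) +
      (1 / (3 * (real k + 1)) + 1 / (3 * real k + 4) + 1 / (3 * real k + 5))"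
    by (simp only: harm_Suc) (simp add: inverse_eq_divide algebra_simps)
  have h1: "harm (Suc k) = (harm k :: real) + 1 / (real k + 1)"
    by (simp add: harm_Suc inverse_eq_divide add.commute)
  have "1 / (1/3 + real (Suc k)) = 3 * (1 / (3 * real k + 4))"
    "1 / (1/3 + 1/3 + real (Suc k)) = 3 * (1 / (3 * real k + 5))"
    by (simp_all add: divide_simps)
  then have "recip_sum (1/3) (Suc k) (1/3) =
      recip_sum (1/3) k (1/3) + 3 * (1 / (3 * real k + 4)) + 3 * (1 / (3 * real k + 5))"
    by (simp add: recip_sum_def)
  moreover have "1 / (real k + 1) = 3 * (1 / (3 * (real k + 1)))" by (simp add: field_simps)
  ultimately show ?case unfolding Suc h1 h3 by (simp only: distrib_left)
qed

lemma wz_num_third: "wz_num (1/3) k (1/3) = (3 * real k + 2) * (15 * real k + 11) / 18"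
  by (simp add: wz_num_def field_simps power2_eq_square)

lemma binomial_products_conv_fact:
  "real (2 * k choose k) ^ 2 * real (3 * k choose k) =
     fact (2 * k) * fact (3 * k) / fact k ^ 5"
proof -
  have "real (2 * k choose k) = fact (2 * k) / (fact k * fact k)"
    by (subst binomial_fact) auto
  moreover have "real (3 * k choose k) = fact (3 * k) / (fact k * fact (2 * k))"
    by (subst binomial_fact) (auto simp: mult_2[symmetric])
  ultimately show ?thesis
    by (simp add: power2_eq_square eval_nat_numeral)
qed

text \<open>
  The factors \<open>(4/3)\<^sub>k (2/3)\<^sub>k\<close> of the coefficient cancel, up to a rational factor, one of the two copies of
  \<open>(1/3)\<^bsub>k+1\<^esub> (2/3)\<^bsub>k+1\<^esub>\<close> in the denominator. The other copy is \<open>(3k + 3)! / (27\<^bsup>k+1\<^esup> (k + 1)!)\<close>.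
  In the proof both sides have the same quotient \<open>r\<close> of consecutive terms.
\<close>
lemma coeff_recip_third:
  "wz_coeff (1/3) k * wz_recip (1/3) k (1/3) * (3 * real k + 2) / 18 =
     - ((-27) ^ Suc k * fact (Suc k) ^ 5 / ((real k + 1) ^ 3 * fact (2 * Suc k) * fact (3 * Suc k)))"
proof (induction k)
  case 0
  show ?case by (simp add: wz_coeff_def wz_recip_def eval_nat_numeral)
next
  case (Suc k)
  define K where "K = real k"
  have K: "K + 1 \<noteq> 0" "K + 2 \<noteq> 0" "2 * K + 3 \<noteq> 0" "3 * K + 2 \<noteq> 0" "3 * K + 4 \<noteq> 0" "3 * K + 5 \<noteq> 0"
    by (auto simp: K_def)
  have f1: "fact (Suc (Suc k)) = (K + 2) * fact (Suc k)"
    by (simp add: K_def)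
  have "2 * Suc (Suc k) = Suc (Suc (2 * Suc k))" by simp
  then have f2: "fact (2 * Suc (Suc k)) = (2 * K + 4) * (2 * K + 3) * (fact (2 * Suc k) :: real)"
    by (simp only: fact_Suc) (simp add: K_def algebra_simps)
  have "3 * Suc (Suc k) = Suc (Suc (Suc (3 * Suc k)))" by simp
  then have f3: "fact (3 * Suc (Suc k)) =
      (3 * K + 6) * (3 * K + 5) * (3 * K + 4) * (fact (3 * Suc k) :: real)"
    by (simp only: fact_Suc) (simp add: K_def algebra_simps)
  define r where "r = - 9 * (K + 1)^3 / (2 * (2 * K + 3) * (3 * K + 4) * (3 * K + 5))"
  have "wz_coeff (1/3) (Suc k) * wz_recip (1/3) (Suc k) (1/3) * (3 * (K + 1) + 2) / 18
      = r * (wz_coeff (1/3) k * wz_recip (1/3) k (1/3) * (3 * K + 2) / 18)"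
    unfolding wz_coeff_Suc wz_recip_Suc K_def[symmetric] r_def using K by (simp add: divide_simps) algebra
  also have "\<dots> = r * (- ((-27) ^ Suc k * fact (Suc k) ^ 5 /
       ((K + 1) ^ 3 * fact (2 * Suc k) * fact (3 * Suc k))))"
    unfolding K_def Suc ..
  also have "\<dots> = - ((-27) ^ Suc (Suc k) * ((K + 2) * fact (Suc k)) ^ 5 /
       ((K + 2) ^ 3 * ((2 * K + 4) * (2 * K + 3) * fact (2 * Suc k)) *
         ((3 * K + 6) * (3 * K + 5) * (3 * K + 4) * fact (3 * Suc k))))"
  proof -
    show ?thesis
      unfolding r_def power_Suc[of "-27 :: real" "Suc k"]
      using K by (simp add: divide_simps del: fact_Suc power_Suc) algebra
  qed
  also have "K + 1 = real (Suc k)" by (simp add: K_def)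
  also have "(K + 2) ^ 3 = (real (Suc k) + 1) ^ 3" by (simp add: K_def add.commute)
  finally show ?case unfolding f1 f2 f3 .
qed

theorem theorem1p1:
  "(\<lambda>n::nat. let k = n + 1 in
      (-27) ^ k / (real k ^ 3 * real ((2 * k) choose k) ^ 2 * real ((3 * k) choose k))
        * ((15 * real k - 4) * (3 * harm (3 * k - 1) - harm (k - 1)) - 9))
    sums (- (4 * pi ^ 3 / sqrt 3))"
proof -
  have term_eq: "wzF' (1/3) n (1/3) / 2 = (let k = n + 1 in
      (-27) ^ k / (real k ^ 3 * real ((2 * k) choose k) ^ 2 * real ((3 * k) choose k))
        * ((15 * real k - 4) * (3 * harm (3 * k - 1) - harm (k - 1)) - 9))" for n
  proof -
    define T where "T = (-27) ^ Suc n / (real (Suc n) ^ 3 * real (2 * Suc n choose Suc n) ^ 2 *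
      real (3 * Suc n choose Suc n))"
    define H where "H = 3 * harm (3 * n + 2) - (harm n :: real)"
    have cr: "wz_coeff (1/3) n * wz_recip (1/3) n (1/3) * (3 * real n + 2) = - 18 * T"
      using coeff_recip_third[of n] unfolding T_def mult.assoc binomial_products_conv_fact
      by (simp add: add.commute mult.assoc del: fact_Suc power_Suc)
    have "wzF' (1/3) n (1/3) / 2 = wz_coeff (1/3) n * wz_recip (1/3) n (1/3) * (3 * real n + 2) *
        (9 - (15 * real n + 11) * H) / 18"
      unfolding wzF'_def recip_sum_third wz_num_third H_def[symmetric] by (simp add: field_simps)
    also have "\<dots> = T * ((15 * real n + 11) * H - 9)"
      unfolding cr by (simp add: field_simps)
    finally show ?thesis by (simp add: T_def H_def Let_def del: power_Suc)
  qed
  have "(\<lambda>n. wzF' (1/3) n (1/3) / 2) sums (- 2 * (4 * pi ^ 3 / (3 * sqrt 3)) / (1/3) / 2)"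
    using inverse_cube_third_sums by (intro sums_divide accelerated_inverse_cube_sums) simp_all
  moreover have "- 2 * (4 * pi ^ 3 / (3 * sqrt 3)) / (1/3) / 2 = - (4 * pi ^ 3 / sqrt 3)"
    by simp
  ultimately show ?thesis unfolding term_eq by (simp only:)
qed

end
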